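(* Let $E$ be a uniformly smooth and uniformly convex real Banach space with normalized duality mapping $J:E\to E^{*}$, and let $h_k:E\to(-\infty,+\infty]$, $k\in\mathbb N$, be proper, convex and lower semicontinuous functions. Suppose that $$B_3:=\bigcap_{k=1}^{\infty}\operatorname*{argmin}_{x\in E}h_k(x)$$ is nonempty, closed and convex. Let $\rho:\mathbb N\to\mathbb N$ be a map such that every positive integer occurs infinitely often in $\{\rho(n)\}$, and let $\{r_n\}\subset[a,\infty)$ for some $a>0$. Define $\{x_n\}$ by $x_1=x\in E$, $C_1=E$ and, for all $n\in\mathbb N$, $$\begin{aligned} q_n&=(J+r_n\partial h_{\rho(n)})^{-1}Jx_n,\\ C_{n+1}&=\{v\in C_n:\phi(v,q_n)\le\phi(v,x_n)\},\\ x_{n+1}&=\Pi_{C_{n+1}}x . \end{aligned}$$ Then $x_n\to\Pi_{B_3}x$ strongly.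
   Context: $\langle x,x^{*}\rangle$ is the pairing of $x\in E$ with $x^{*}\in E^{*}$. $J$ is the normalized duality mapping: $Jx$ is the unique $x^*\in E^*$ with $\langle x,x^{*}\rangle=\|x\|\|x^{*}\|$ and $\|x^{*}\|=\|x\|$. The Lyapunov functional is $\phi(x,y)=\|x\|^{2}-2\langle x,Jy\rangle+\|y\|^{2}$ for $x,y\in E$. For $D\subset E$ nonempty, closed and convex, the generalized projection $\Pi_Dx$ is the unique minimizer of $y\mapsto\phi(y,x)$ over $y\in D$. $\partial h:E\to2^{E^{*}}$ is the convex subdifferential. The point $q=(J+r\,\partial h)^{-1}Jx$ is the unique $q\in E$ with $\frac{Jx-Jq}{r}\in\partial h(q)$. *)

theory Defs
  imports "HOL-Analysis.Analysis"
begin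

text \<open>The dual space of \<open>'a\<close> is the type \<open>'a \<Rightarrow>\<^sub>L real\<close> of bounded linear functionals with the
  operator norm; the pairing of \<open>x\<close> with \<open>f\<close> is \<open>blinfun_apply f x\<close>.\<close>

definition uniformly_convex :: "'a::real_normed_vector itself \<Rightarrow> bool" where
  "uniformly_convex _ \<longleftrightarrow>
     (\<forall>\<epsilon>>0. \<exists>\<delta>>0. \<forall>x y :: 'a.
        norm x = 1 \<longrightarrow> norm y = 1 \<longrightarrow> norm (x - y) \<ge> \<epsilon> \<longrightarrow> norm ((x + y) /\<^sub>R 2) \<le> 1 - \<delta>)"

text \<open>With the modulus of smoothness
  \<open>\<rho>(t) = sup {(\<parallel>x + y\<parallel> + \<parallel>x - y\<parallel>) / 2 - 1 | \<parallel>x\<parallel> = 1, \<parallel>y\<parallel> = t}\<close>,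
  this says that \<open>\<rho>(t) / t\<close> tends to \<open>0\<close> as \<open>t\<close> decreases to \<open>0\<close>.\<close>

definition uniformly_smooth :: "'a::real_normed_vector itself \<Rightarrow> bool" where
  "uniformly_smooth _ \<longleftrightarrow>
     (\<forall>\<epsilon>>0. \<exists>\<delta>>0. \<forall>x y :: 'a.
        norm x = 1 \<longrightarrow> norm y \<le> \<delta> \<longrightarrow> norm (x + y) + norm (x - y) \<le> 2 + \<epsilon> * norm y)"

definition duality_map :: "'a::real_normed_vector \<Rightarrow> ('a \<Rightarrow>\<^sub>L real)" where
  "duality_map x = (THE f. blinfun_apply f x = norm x * norm f \<and> norm f = norm x)"

definition lyapunov :: "'a::real_normed_vector \<Rightarrow> 'a \<Rightarrow> real" where
  "lyapunov x y = (norm x)\<^sup>2 - 2 * blinfun_apply (duality_map y) x + (norm y)\<^sup>2"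

definition gen_proj :: "'a::real_normed_vector set \<Rightarrow> 'a \<Rightarrow> 'a" where
  "gen_proj D x = (THE y. is_arg_min (\<lambda>y. lyapunov y x) (\<lambda>y. y \<in> D) y)"

definition proper_fun :: "('a \<Rightarrow> ereal) \<Rightarrow> bool" where
  "proper_fun h \<longleftrightarrow> (\<forall>x. h x \<noteq> - \<infinity>) \<and> (\<exists>x. h x \<noteq> \<infinity>)"

text \<open>Only meaningful for functions that avoid \<open>- \<infinity>\<close>, since \<open>\<infinity> + (- \<infinity>) = \<infinity>\<close> in \<open>ereal\<close>.\<close>

definition convex_fun :: "('a::real_vector \<Rightarrow> ereal) \<Rightarrow> bool" where
  "convex_fun h \<longleftrightarrow>
     (\<forall>x y. \<forall>t\<in>{0<..<1}.
        h ((1 - t) *\<^sub>R x + t *\<^sub>R y) \<le> ereal (1 - t) * h x + ereal t * h y)"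

definition lsc_fun :: "('a::topological_space \<Rightarrow> ereal) \<Rightarrow> bool" where
  "lsc_fun h \<longleftrightarrow> (\<forall>x. h x \<le> Liminf (at x) h)"

definition argmin_set :: "('a \<Rightarrow> ereal) \<Rightarrow> 'a set" where
  "argmin_set h = {x. is_arg_min h (\<lambda>_. True) x}"

text \<open>For proper \<open>h\<close> this is empty at points where \<open>h\<close> is \<open>\<infinity>\<close>.\<close>

definition subdifferential :: "('a::real_normed_vector \<Rightarrow> ereal) \<Rightarrow> 'a \<Rightarrow> ('a \<Rightarrow>\<^sub>L real) set" where
  "subdifferential h x = {f. \<forall>y. h x + ereal (blinfun_apply f (y - x)) \<le> h y}"

text \<open>The point \<open>(J + r \<partial>h)\<^sup>-\<^sup>1 (J x)\<close>.\<close>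

definition resolvent :: "real \<Rightarrow> ('a::real_normed_vector \<Rightarrow> ereal) \<Rightarrow> 'a \<Rightarrow> 'a" where
  "resolvent r h x = (THE q. (duality_map x - duality_map q) /\<^sub>R r \<in> subdifferential h q)"

end

theory Submission imports Defs begin

text \<open>
  Uniform smoothness makes the directional derivative of the norm linear, so the duality map is
  obtained as a derivative, without the Hahn--Banach theorem. It is norm-to-weak* continuous, which
  suffices throughout. Uniform convexity makes minimising sequences of \<open>g + \<parallel>\<cdot>\<parallel>\<^sup>2 - 2 f\<close> Cauchy for
  every lower semicontinuous convex \<open>g\<close> that is bounded below, so such functions have minimisers
  without an appeal to reflexivity. Generalized projections and resolvents are instances, with
  \<open>g\<close> an indicator function and \<open>g = 2 r h\<close>.

  Resolvents and projections do not increase the Lyapunov distance to minimisers and to points of the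
  set, respectively, so \<open>B\<^sub>3 \<subseteq> C\<^sub>n\<close> and \<open>\<phi>(x\<^sub>n, x)\<close> increases and is bounded by \<open>\<phi>(v, x)\<close> for
  \<open>v \<in> B\<^sub>3\<close>. For \<open>m \<ge> n\<close> we have \<open>\<phi>(x\<^sub>m, x\<^sub>n) \<le> \<phi>(x\<^sub>m, x) - \<phi>(x\<^sub>n, x)\<close>, hence \<open>x\<^sub>n\<close> is Cauchy, with limit \<open>w\<close>,
  and \<open>q\<^sub>n\<close> has the same limit. Along the indices with \<open>\<rho>(n) = k\<close> the subgradient inequality
  at \<open>q\<^sub>n\<close> passes to the limit, so \<open>w\<close> minimises every \<open>h\<^sub>k\<close>; the bound on \<open>\<phi>(x\<^sub>n, x)\<close> identifies \<open>w\<close>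
  as the projection onto \<open>B\<^sub>3\<close>.
\<close>

section \<open>Smoothness of the norm and the duality map\<close>

text \<open>By convexity of the norm the difference quotient \<open>d v t\<close> increases with
  \<open>t\<close>, so its limit at \<open>0\<close> from the right is its infimum
  \<open>p v\<close>. This \<open>p\<close> is sublinear; uniform smoothness adds
  \<open>p v + p (- v) \<le> 0\<close>, and an odd sublinear function is linear.\<close>

lemma norm_directional_derivative:
  fixes x :: "'a::real_normed_vector"
  assumes us: "uniformly_smooth TYPE('a)" and x: "x \<noteq> 0"
  obtains p where "linear p"
    and "\<And>v. ((\<lambda>t. (norm (x + t *\<^sub>R v) - norm x) / t) \<longlongrightarrow> p v) (at_right 0)"
proof -
  define d where "d v t = (norm (x + t *\<^sub>R v) - norm x) / t" for v and t :: real
  define p where "p v = (INF t\<in>{0<..}. d v t)" for v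
  have mono: "d v s \<le> d v t" if "0 < s" "s \<le> t" for v s t
  proof -
    have "x + s *\<^sub>R v = (1 - s/t) *\<^sub>R x + (s/t) *\<^sub>R (x + t *\<^sub>R v)"
      using that by (simp add: algebra_simps)
    also have "norm \<dots> \<le> (1 - s/t) * norm x + (s/t) * norm (x + t *\<^sub>R v)"
      using that by (intro norm_triangle_le) simp
    finally have "norm (x + s *\<^sub>R v) - norm x \<le> (s/t) * (norm (x + t *\<^sub>R v) - norm x)"
      by (simp add: algebra_simps)
    then show ?thesis using that by (simp add: d_def field_simps)
  qed
  have lower: "- norm v \<le> d v t" if "t > 0" for v t
  proof -
    have "norm x - norm (x + t *\<^sub>R v) \<le> t * norm v"
      using norm_triangle_ineq2[of x "x + t *\<^sub>R v"] that by simp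
    then show ?thesis using that by (simp add: d_def field_simps)
  qed
  have bdd: "bdd_below (d v ` {0<..})" for v
    using lower by (auto simp: bdd_below_def)
  have p_le: "p v \<le> d v t" if "t > 0" for v t
    unfolding p_def using that bdd by (intro cINF_lower) auto
  have lim: "(d v \<longlongrightarrow> p v) (at_right 0)" for v
  proof (rule order_tendstoI)
    fix a assume "a < p v"
    then have "a < d v t" if "t > 0" for t
      using p_le[OF that, of v] by simp
    then show "\<forall>\<^sub>F t in at_right 0. a < d v t"
      by (auto intro!: eventually_at_rightI[of 0 1])
  next
    fix a assume "p v < a"
    then obtain t where t: "t > 0" "d v t < a"
      unfolding p_def using bdd by (subst (asm) cINF_less_iff) auto
    have "d v s < a" if "s \<in> {0<..<t}" for s
      using mono[of s t v] that t by simp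
    then show "\<forall>\<^sub>F s in at_right 0. d v s < a"
      using t(1) by (rule eventually_at_rightI)
  qed
  have lim_scaled: "((\<lambda>t. d v (c * t)) \<longlongrightarrow> p v) (at_right 0)" if "c > 0" for c v
  proof (rule filterlim_compose[OF lim])
    have "((\<lambda>t. c * t) \<longlongrightarrow> c * 0) (at_right 0)"
      by (intro tendsto_intros)
    then show "filterlim (\<lambda>t. c * t) (at_right 0) (at_right 0)"
      using that by (intro tendsto_imp_filterlim_at_right) (auto intro!: eventually_at_rightI[of 0 1])
  qed
  have scale: "p (c *\<^sub>R v) = c * p v" if "c > 0" for c v
  proof (rule tendsto_unique[OF _ lim])
    have "d (c *\<^sub>R v) t = c * d v (c * t)" for t
      using that by (simp add: d_def mult.commute)
    then show "(d (c *\<^sub>R v) \<longlongrightarrow> c * p v) (at_right 0)"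
      using tendsto_mult_left[OF lim_scaled[OF that]] by presburger
  qed simp
  have zero: "p 0 = 0"
    by (simp add: p_def d_def)
  \<comment> \<open>\<open>x + t (v + w)\<close> is the midpoint of \<open>x + 2 t v\<close> and
    \<open>x + 2 t w\<close>; this is why the quotients of \<open>v\<close> and \<open>w\<close> are
    taken at \<open>2 * t\<close>.\<close>
  have subadd: "p (v + w) \<le> p v + p w" for v w
  proof (rule tendsto_le[OF _ tendsto_add[OF lim_scaled[of 2] lim_scaled[of 2]] lim])
    have "d (v + w) t \<le> d v (2 * t) + d w (2 * t)" if "t > 0" for t
    proof -
      have sum: "(x + (2 * t) *\<^sub>R v) + (x + (2 * t) *\<^sub>R w) = 2 *\<^sub>R (x + t *\<^sub>R (v + w))"
        by (simp add: scaleR_add_right scaleR_2[of x] ac_simps)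
      have "2 * norm (x + t *\<^sub>R (v + w)) = norm ((x + (2 * t) *\<^sub>R v) + (x + (2 * t) *\<^sub>R w))"
        using sum by simp
      also have "\<dots> \<le> norm (x + (2 * t) *\<^sub>R v) + norm (x + (2 * t) *\<^sub>R w)"
        by (rule norm_triangle_ineq)
      finally have "(2 * norm (x + t *\<^sub>R (v + w)) - 2 * norm x) / (2 * t) \<le>
          (norm (x + (2 * t) *\<^sub>R v) + norm (x + (2 * t) *\<^sub>R w) - 2 * norm x) / (2 * t)"
        using that by (intro divide_right_mono) auto
      then show ?thesis using that by (simp add: d_def add_divide_distrib diff_divide_distrib)
    qed
    then show "\<forall>\<^sub>F t in at_right 0. d (v + w) t \<le> d v (2 * t) + d w (2 * t)"
      by (auto intro!: eventually_at_rightI[of 0 1])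
  qed auto
  have minus_le: "p v + p (- v) \<le> 0" for v
  proof (rule field_le_epsilon)
    fix e :: real assume e: "e > 0"
    define e' where "e' = e / (norm v + 1)"
    have e': "e' > 0" using e by (auto simp: e'_def add_nonneg_pos)
    then obtain s where s: "s > 0"
      "\<And>u w :: 'a. norm u = 1 \<Longrightarrow> norm w \<le> s \<Longrightarrow> norm (u + w) + norm (u - w) \<le> 2 + e' * norm w"
      using us unfolding uniformly_smooth_def by metis
    \<comment> \<open>Uniform smoothness is applied to \<open>x\<close> and \<open>t v\<close>, both
      divided by \<open>norm x\<close>; this \<open>t\<close> makes the second vector no longer than
      \<open>s\<close>. The summand 1 in the denominators of \<open>t\<close> and \<open>e'\<close>
      covers \<open>v = 0\<close>.\<close>
    define t where "t = s * norm x / (norm v + 1)"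
    have t: "t > 0" using s x by (auto simp: t_def add_nonneg_pos)
    let ?u = "x /\<^sub>R norm x" and ?w = "(t / norm x) *\<^sub>R v"
    have "norm (?u + ?w) + norm (?u - ?w) \<le> 2 + e' * norm ?w"
    proof (rule s(2))
      show "norm ?u = 1" using x by simp
      have "norm ?w = s * (norm v / (norm v + 1))" using x s by (simp add: t_def)
      also have "\<dots> \<le> s * 1"
        using s by (intro mult_left_mono) (auto simp: divide_le_eq add_nonneg_pos)
      finally show "norm ?w \<le> s" by simp
    qed
    moreover have "?u + ?w = (x + t *\<^sub>R v) /\<^sub>R norm x" "?u - ?w = (x - t *\<^sub>R v) /\<^sub>R norm x"
      by (simp_all add: scaleR_add_right scaleR_diff_right divide_inverse mult.commute)
    then have "norm (?u + ?w) = norm (x + t *\<^sub>R v) / norm x" "norm (?u - ?w) = norm (x - t *\<^sub>R v) / norm x"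
      by (simp_all only: norm_scaleR) (simp_all add: divide_inverse mult.commute)
    moreover have "norm ?w = t * norm v / norm x" using t by simp
    ultimately have "(norm (x + t *\<^sub>R v) + norm (x - t *\<^sub>R v)) / norm x \<le>
        (2 * norm x + e' * (t * norm v)) / norm x"
      using x by (simp only: add_divide_distrib) simp
    then have "norm (x + t *\<^sub>R v) + norm (x - t *\<^sub>R v) \<le> 2 * norm x + e' * (t * norm v)"
      using x by (simp add: divide_le_cancel)
    then have "(norm (x + t *\<^sub>R v) + norm (x - t *\<^sub>R v) - 2 * norm x) / t \<le> e' * norm v"
      using t by (simp add: pos_divide_le_eq mult.commute mult.left_commute)
    then have "d v t + d (- v) t \<le> e' * norm v"
      by (simp add: d_def add_divide_distrib diff_divide_distrib)
    also have "\<dots> \<le> e"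
      using e add_nonneg_pos[OF norm_ge_zero[of v] zero_less_one]
      by (simp add: e'_def pos_divide_le_eq distrib_left)
    finally show "p v + p (- v) \<le> 0 + e"
      using p_le[OF t, of v] p_le[OF t, of "- v"] by simp
  qed
  have minus: "p (- v) = - p v" for v
    using minus_le[of v] subadd[of v "- v"] zero by simp
  have "linear p"
  proof (rule linearI)
    show "p (v + w) = p v + p w" for v w
      using subadd[of v w] subadd[of "- v" "- w"] minus[of "v + w"] minus[of v] minus[of w] by simp
    show "p (c *\<^sub>R v) = c *\<^sub>R p v" for c v
      using scale[of c v] scale[of "- c" v] minus[of "c *\<^sub>R v"] zero
      by (cases c "0::real" rule: linorder_cases) auto
  qed
  then show ?thesis using that lim unfolding d_def by blast
qed

text \<open>For \<open>x \<noteq> 0\<close> the functional is \<open>norm x\<close> times the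
  derivative \<open>p\<close> of the norm at \<open>x\<close>. Any competitor \<open>f\<close>
  satisfies \<open>f (x + t v) \<le> norm x * norm (x + t v)\<close> with equality at
  \<open>t = 0\<close>; dividing by \<open>t\<close> and letting \<open>t\<close> tend to
  \<open>0\<close> gives \<open>f v \<le> F v\<close>, and \<open>- v\<close> gives the reverse.
  Both claims are proved together because evaluating the description \<open>duality_map x\<close> in
  the second one requires the first.\<close>

lemma duality_map_existence:
  fixes x :: "'a::real_normed_vector"
  assumes us: "uniformly_smooth TYPE('a)"
  shows duality_map_ex1: "\<exists>!f. blinfun_apply f x = norm x * norm f \<and> norm f = norm x"
    and norm_square_directional_derivative: "((\<lambda>t. ((norm (x + t *\<^sub>R v))\<^sup>2 - (norm x)\<^sup>2) / t) \<longlongrightarrow> 2 * blinfun_apply (duality_map x) v)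
      (at_right 0)"
proof -
  have "(\<exists>!f. blinfun_apply f x = norm x * norm f \<and> norm f = norm x) \<and>
    ((\<lambda>t. ((norm (x + t *\<^sub>R v))\<^sup>2 - (norm x)\<^sup>2) / t) \<longlongrightarrow> 2 * blinfun_apply (duality_map x) v) (at_right 0)"
  proof (cases "x = 0")
    case True
    then have ex1: "\<exists>!f. blinfun_apply f x = norm x * norm f \<and> norm f = norm x"
      by (auto intro!: ex1I[of _ 0])
    have J: "duality_map x = 0"
      unfolding duality_map_def using True by (intro the1_equality[OF ex1]) auto
    have "((\<lambda>t. t * (norm v)\<^sup>2) \<longlongrightarrow> 0) (at_right 0)"
      by (auto intro!: tendsto_eq_intros)
    then have "((\<lambda>t. (norm (t *\<^sub>R v))\<^sup>2 / t) \<longlongrightarrow> 0) (at_right 0)"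
      by (rule Lim_transform_eventually)
        (auto intro!: eventually_at_rightI[of 0 1] simp: power2_eq_square)
    then show ?thesis using ex1 J True by simp
  next
    case False
    obtain p where lin: "linear p"
      and lim: "\<And>v. ((\<lambda>t. (norm (x + t *\<^sub>R v) - norm x) / t) \<longlongrightarrow> p v) (at_right 0)"
      using norm_directional_derivative[OF us False] by blast
    have le: "p v \<le> norm v" for v
    proof (rule tendsto_le[OF _ tendsto_const lim])
      have "(norm (x + t *\<^sub>R v) - norm x) / t \<le> norm v" if "t > 0" for t
        using norm_triangle_ineq[of x "t *\<^sub>R v"] that by (simp add: field_simps)
      then show "\<forall>\<^sub>F t in at_right 0. (norm (x + t *\<^sub>R v) - norm x) / t \<le> norm v"
        by (auto intro!: eventually_at_rightI[of 0 1])
    qed simp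
    have abs_le: "\<bar>p v\<bar> \<le> norm v" for v
      using le[of v] le[of "- v"] linear_neg[OF lin, of v] by simp
    have bl: "bounded_linear p"
      using lin abs_le by (auto simp: bounded_linear_def bounded_linear_axioms_def intro: exI[of _ 1])
    have px: "p x = norm x"
    proof (rule tendsto_unique[OF _ lim])
      have "(norm (x + t *\<^sub>R x) - norm x) / t = norm x" if "t > 0" for t
      proof -
        have "norm (x + t *\<^sub>R x) = (1 + t) * norm x"
          using that norm_scaleR[of "1 + t" x] by (simp add: scaleR_add_left)
        then show ?thesis using that by (simp add: field_simps)
      qed
      then show "((\<lambda>t. (norm (x + t *\<^sub>R x) - norm x) / t) \<longlongrightarrow> norm x) (at_right 0)"
        by (intro tendsto_eventually) (auto intro!: eventually_at_rightI[of 0 1])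
    qed simp
    define F where "F = norm x *\<^sub>R Blinfun p"
    have F: "blinfun_apply F v = norm x * p v" for v
      by (simp add: F_def bounded_linear_Blinfun_apply[OF bl] blinfun.scaleR_left)
    have "norm (Blinfun p) = 1"
    proof (rule antisym)
      show "norm (Blinfun p) \<le> 1"
        by (rule norm_blinfun_bound) (auto simp: bounded_linear_Blinfun_apply[OF bl] abs_le)
      have "norm x \<le> norm (Blinfun p) * norm x"
        using norm_blinfun[of "Blinfun p" x] by (simp add: bounded_linear_Blinfun_apply[OF bl] px)
      then show "1 \<le> norm (Blinfun p)" using False by simp
    qed
    then have nF: "norm F = norm x" by (simp add: F_def)
    have uniq: "f = F" if f: "blinfun_apply f x = norm x * norm f" "norm f = norm x" for f
    proof -
      have f_le: "blinfun_apply f v \<le> blinfun_apply F v" for v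
      proof (rule tendsto_le[OF _ _ tendsto_const])
        show "((\<lambda>t. norm x * ((norm (x + t *\<^sub>R v) - norm x) / t)) \<longlongrightarrow> blinfun_apply F v) (at_right 0)"
          unfolding F by (intro tendsto_mult_left lim)
        have "blinfun_apply f v \<le> norm x * ((norm (x + t *\<^sub>R v) - norm x) / t)" if "t > 0" for t
        proof -
          have "blinfun_apply f (x + t *\<^sub>R v) \<le> norm x * norm (x + t *\<^sub>R v)"
            using norm_blinfun[of f "x + t *\<^sub>R v"] f by simp
          then show ?thesis
            using that f by (simp add: blinfun.add_right blinfun.scaleR_right field_simps)
        qed
        then show "\<forall>\<^sub>F t in at_right 0. blinfun_apply f v \<le> norm x * ((norm (x + t *\<^sub>R v) - norm x) / t)"
          by (auto intro!: eventually_at_rightI[of 0 1])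
      qed simp
      show ?thesis
      proof (rule blinfun_eqI)
        show "blinfun_apply f v = blinfun_apply F v" for v
          using f_le[of v] f_le[of "- v"] by (simp add: blinfun.minus_right)
      qed
    qed
    have ex1: "\<exists>!f. blinfun_apply f x = norm x * norm f \<and> norm f = norm x"
      using uniq nF by (intro ex1I[of _ F]) (auto simp: F px)
    have J: "duality_map x = F"
      unfolding duality_map_def using nF by (intro the1_equality[OF ex1]) (auto simp: F px)
    \<comment> \<open>The quotient of the squared norm factors as a difference of squares; the
      second factor tends to \<open>2 * norm x\<close>.\<close>
    have "((\<lambda>t. (norm (x + t *\<^sub>R v) - norm x) / t * (norm (x + t *\<^sub>R v) + norm x)) \<longlongrightarrow>
      p v * (norm (x + 0 *\<^sub>R v) + norm x)) (at_right 0)"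
      by (intro tendsto_intros lim)
    moreover have "(norm (x + t *\<^sub>R v) - norm x) / t * (norm (x + t *\<^sub>R v) + norm x) =
      ((norm (x + t *\<^sub>R v))\<^sup>2 - (norm x)\<^sup>2) / t" for t
      by (simp add: power2_eq_square square_diff_square_factored)
    ultimately have "((\<lambda>t. ((norm (x + t *\<^sub>R v))\<^sup>2 - (norm x)\<^sup>2) / t) \<longlongrightarrow>
      p v * (norm (x + 0 *\<^sub>R v) + norm x)) (at_right 0)"
      by (simp only:)
    then show ?thesis using ex1 by (simp add: J F algebra_simps)
  qed
  then show "\<exists>!f. blinfun_apply f x = norm x * norm f \<and> norm f = norm x"
    and "((\<lambda>t. ((norm (x + t *\<^sub>R v))\<^sup>2 - (norm x)\<^sup>2) / t) \<longlongrightarrow> 2 * blinfun_apply (duality_map x) v)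
      (at_right 0)"
    by auto
qed

lemma norm_duality_map:
  fixes x :: "'a::real_normed_vector"
  assumes "uniformly_smooth TYPE('a)"
  shows "norm (duality_map x) = norm x"
  using theI'[OF duality_map_ex1[OF assms, of x]] by (simp add: duality_map_def)

lemma duality_map_self:
  fixes x :: "'a::real_normed_vector"
  assumes "uniformly_smooth TYPE('a)"
  shows "blinfun_apply (duality_map x) x = (norm x)\<^sup>2"
  using theI'[OF duality_map_ex1[OF assms, of x]] by (simp add: duality_map_def power2_eq_square)

lemma duality_map_le:
  fixes x :: "'a::real_normed_vector"
  assumes "uniformly_smooth TYPE('a)"
  shows "\<bar>blinfun_apply (duality_map x) y\<bar> \<le> norm x * norm y"
  using norm_blinfun[of "duality_map x" y] by (simp add: norm_duality_map[OF assms])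

section \<open>The Lyapunov functional and continuity of the duality map\<close>

lemma lyapunov_lower:
  fixes x :: "'a::real_normed_vector"
  assumes "uniformly_smooth TYPE('a)"
  shows "(norm x - norm y)\<^sup>2 \<le> lyapunov x y"
  using duality_map_le[OF assms, of y x] by (simp add: lyapunov_def power2_diff algebra_simps)

lemma lyapunov_nonneg:
  fixes x :: "'a::real_normed_vector"
  assumes "uniformly_smooth TYPE('a)"
  shows "0 \<le> lyapunov x y"
  using lyapunov_lower[OF assms] by (rule order_trans[rotated]) simp

lemma lyapunov_self:
  fixes x :: "'a::real_normed_vector"
  assumes "uniformly_smooth TYPE('a)"
  shows "lyapunov x x = 0"
  by (simp add: lyapunov_def duality_map_self[OF assms])

text \<open>Reduces the inequalities for projections and resolvents to the sign of the pairing on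
  the right.\<close>

lemma lyapunov_three_point:
  fixes x :: "'a::real_normed_vector"
  assumes "uniformly_smooth TYPE('a)"
  shows "lyapunov y p + lyapunov p x = lyapunov y x + 2 * blinfun_apply (duality_map x - duality_map p) (y - p)"
  by (simp add: lyapunov_def duality_map_self[OF assms] blinfun.diff_left blinfun.diff_right algebra_simps)

text \<open>Nonnegativity of \<open>lyapunov (x n + t v) (x n)\<close> bounds the pairing of
  \<open>v\<close> with \<open>J (x n)\<close> by half the difference quotient of the squared norm
  at \<open>x n\<close>. For a fixed small \<open>t\<close> this quotient converges to the one at
  \<open>w\<close>, which is close to twice the pairing with \<open>J w\<close>. Applied to
  \<open>- v\<close>, the upper bound becomes the lower one.\<close>

lemma duality_map_tendsto:
  fixes x :: "nat \<Rightarrow> 'a::real_normed_vector"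
  assumes us: "uniformly_smooth TYPE('a)" and x: "x \<longlonglongrightarrow> w"
  shows "(\<lambda>n. blinfun_apply (duality_map (x n)) v) \<longlonglongrightarrow> blinfun_apply (duality_map w) v"
proof -
  have upper: "\<forall>\<^sub>F n in sequentially. blinfun_apply (duality_map (x n)) v < c"
    if "blinfun_apply (duality_map w) v < c" for c v
  proof -
    have "\<forall>\<^sub>F t in at_right 0. ((norm (w + t *\<^sub>R v))\<^sup>2 - (norm w)\<^sup>2) / t < 2 * c \<and> t > 0"
      using that by (intro eventually_conj order_tendstoD(2)[OF norm_square_directional_derivative[OF us]])
        (auto simp: eventually_at_right_less)
    then obtain t where t: "((norm (w + t *\<^sub>R v))\<^sup>2 - (norm w)\<^sup>2) / t < 2 * c" "t > 0"
      using eventually_happens'[OF trivial_limit_at_right_real] by blast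
    have "(\<lambda>n. ((norm (x n + t *\<^sub>R v))\<^sup>2 - (norm (x n))\<^sup>2) / t) \<longlonglongrightarrow> ((norm (w + t *\<^sub>R v))\<^sup>2 - (norm w)\<^sup>2) / t"
      using t by (intro tendsto_intros x) auto
    then have "\<forall>\<^sub>F n in sequentially. ((norm (x n + t *\<^sub>R v))\<^sup>2 - (norm (x n))\<^sup>2) / t < 2 * c"
      using t(1) by (rule order_tendstoD)
    then show ?thesis
    proof eventually_elim
      case (elim n)
      have "2 * t * blinfun_apply (duality_map (x n)) v \<le> (norm (x n + t *\<^sub>R v))\<^sup>2 - (norm (x n))\<^sup>2"
        using lyapunov_nonneg[OF us, of "x n + t *\<^sub>R v" "x n"]
        by (simp add: lyapunov_def blinfun.add_right blinfun.scaleR_right duality_map_self[OF us])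
      also have "\<dots> < 2 * t * c"
        using elim t(2) by (simp add: pos_divide_less_eq mult.commute mult.left_commute)
      finally show ?case using t(2) by simp
    qed
  qed
  show ?thesis
  proof (rule order_tendstoI)
    fix c assume "c < blinfun_apply (duality_map w) v"
    then show "\<forall>\<^sub>F n in sequentially. c < blinfun_apply (duality_map (x n)) v"
      using upper[of "- v" "- c"] by (simp add: blinfun.minus_right)
  qed (rule upper)
qed

section \<open>Uniform convexity of the squared norm on balls\<close>

text \<open>Either the two norms differ by at least \<open>e / 4\<close>, and strict convexity of
  the real square already gives the gap, or both norms are at least \<open>e / 4\<close> and the
  directions \<open>u\<close>, \<open>v\<close> are at least \<open>e / (2 * R)\<close> apart, so
  that uniform convexity of the unit sphere applies.\<close>

lemma uniformly_convex_norm_square: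
  fixes R :: real
  assumes uc: "uniformly_convex TYPE('a::real_normed_vector)" and e: "e > 0" and R: "R > 0"
  obtains \<delta> where "\<delta> > 0" and "\<And>x y :: 'a. norm x \<le> R \<Longrightarrow> norm y \<le> R \<Longrightarrow> norm (x - y) \<ge> e \<Longrightarrow>
    (norm ((x + y) /\<^sub>R 2))\<^sup>2 \<le> ((norm x)\<^sup>2 + (norm y)\<^sup>2) / 2 - \<delta>"
proof -
  obtain d where d: "d > 0" and mid: "\<And>u v :: 'a. norm u = 1 \<Longrightarrow> norm v = 1 \<Longrightarrow>
      norm (u - v) \<ge> e / (2 * R) \<Longrightarrow> norm ((u + v) /\<^sub>R 2) \<le> 1 - d"
    using uc e R unfolding uniformly_convex_def by (metis divide_pos_pos mult_pos_pos zero_less_numeral)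
  \<comment> \<open>One bound for each case: a difference of norms, and a difference of directions,
    where the gain is \<open>norm y * d \<ge> e * d / 4\<close>.\<close>
  define \<delta> where "\<delta> = min ((e/4)\<^sup>2 / 4) ((e * d / 4)\<^sup>2)"
  have main: "(norm ((x + y) /\<^sub>R 2))\<^sup>2 \<le> ((norm x)\<^sup>2 + (norm y)\<^sup>2) / 2 - \<delta>"
    if le: "norm y \<le> norm x" and xR: "norm x \<le> R" and xy: "norm (x - y) \<ge> e" for x y :: 'a
  proof (cases "norm x - norm y \<ge> e / 4")
    case True
    have "(norm ((x + y) /\<^sub>R 2))\<^sup>2 \<le> ((norm x + norm y) / 2)\<^sup>2"
      using norm_triangle_ineq[of x y] by (intro power_mono) auto
    also have "\<dots> = ((norm x)\<^sup>2 + (norm y)\<^sup>2) / 2 - (norm x - norm y)\<^sup>2 / 4"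
      by (simp add: power2_eq_square field_simps)
    also have "\<dots> \<le> ((norm x)\<^sup>2 + (norm y)\<^sup>2) / 2 - \<delta>"
      using power_mono[OF True, of 2] e by (simp add: \<delta>_def)
    finally show ?thesis .
  next
    case False
    have "e \<le> norm x + norm y"
      using xy norm_triangle_ineq4[of x y] by simp
    then have y_ge: "norm y \<ge> e / 4" using le e False by linarith
    then have pos: "norm x > 0" "norm y > 0" using le e by linarith+
    define u where "u = x /\<^sub>R norm x"
    define v where "v = y /\<^sub>R norm y"
    have x: "x = norm x *\<^sub>R u" and y: "y = norm y *\<^sub>R v" and nu: "norm u = 1" and nv: "norm v = 1"
      using pos by (auto simp: u_def v_def)
    have "x - y = norm x *\<^sub>R (u - v) + (norm x - norm y) *\<^sub>R v"
      by (subst (1) x, subst (1) y) (simp add: algebra_simps)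
    then have "norm (x - y) \<le> norm x * norm (u - v) + (norm x - norm y)"
      using norm_triangle_ineq[of "norm x *\<^sub>R (u - v)" "(norm x - norm y) *\<^sub>R v"] le nv by simp
    then have "e / 2 \<le> norm x * norm (u - v)"
      using xy False e by simp
    also have "\<dots> \<le> R * norm (u - v)" using xR by (intro mult_right_mono) auto
    finally have "norm ((u + v) /\<^sub>R 2) \<le> 1 - d"
      using R by (intro mid nu nv) (simp add: field_simps)
    then have uv: "norm (u + v) \<le> 2 - 2 * d" by simp
    \<comment> \<open>Only the part of \<open>x\<close> of length \<open>norm y\<close> is paired
      with \<open>y\<close>; the gain \<open>2 * d\<close> for unit vectors is thus scaled by
      \<open>norm y\<close>, and the excess costs exactly \<open>norm x - norm y\<close>.\<close>
    have "x + y = norm y *\<^sub>R (u + v) + (norm x - norm y) *\<^sub>R u"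
      by (subst (1) x, subst (1) y) (simp add: algebra_simps)
    then have "norm (x + y) \<le> norm y * norm (u + v) + (norm x - norm y)"
      using norm_triangle_ineq[of "norm y *\<^sub>R (u + v)" "(norm x - norm y) *\<^sub>R u"] le nu by simp
    also have "norm y * norm (u + v) \<le> norm y * (2 - 2 * d)"
      using uv by (intro mult_left_mono) auto
    finally have "norm (x + y) \<le> norm x + norm y - 2 * (norm y * d)"
      by (simp add: algebra_simps)
    moreover define A where "A = (norm x + norm y) / 2"
    ultimately have "norm (x + y) / 2 \<le> A - norm y * d"
      by (simp add: field_simps)
    then have m': "norm ((x + y) /\<^sub>R 2) \<le> A - norm y * d"
      by simp
    \<comment> \<open>For \<open>0 \<le> b \<le> A\<close> one has
      \<open>(A - b)\<^sup>2 \<le> A\<^sup>2 - b\<^sup>2\<close>; here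
      \<open>b = norm y * d\<close>.\<close>
    have "0 \<le> A - norm y * d"
      using m' norm_ge_zero order_trans by blast
    moreover have "0 \<le> norm y * d" using d by simp
    ultimately have "(A - norm y * d)\<^sup>2 \<le> A\<^sup>2 - (norm y * d)\<^sup>2"
      using mult_right_mono[of "norm y * d" A "norm y * d"] by (simp add: power2_eq_square algebra_simps)
    moreover have "(norm ((x + y) /\<^sub>R 2))\<^sup>2 \<le> (A - norm y * d)\<^sup>2"
      using m' by (intro power_mono) auto
    moreover have "A\<^sup>2 \<le> ((norm x)\<^sup>2 + (norm y)\<^sup>2) / 2"
      using zero_le_power2[of "norm x - norm y"] by (simp add: A_def power2_eq_square field_simps)
    moreover have "(e * d / 4)\<^sup>2 \<le> (norm y * d)\<^sup>2"
      using mult_right_mono[OF y_ge, of d] d e by (intro power_mono) auto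
    moreover have "\<delta> \<le> (e * d / 4)\<^sup>2" by (simp add: \<delta>_def)
    ultimately show ?thesis by argo
  qed
  show ?thesis
  proof (rule that)
    show "\<delta> > 0" using e d by (simp add: \<delta>_def)
    show "(norm ((x + y) /\<^sub>R 2))\<^sup>2 \<le> ((norm x)\<^sup>2 + (norm y)\<^sup>2) / 2 - \<delta>"
      if "norm x \<le> R" "norm y \<le> R" "norm (x - y) \<ge> e" for x y :: 'a
      using main[of x y] main[of y x] that
      by (cases "norm y \<le> norm x") (auto simp: norm_minus_commute add.commute)
  qed
qed

text \<open>With \<open>m\<close> the midpoint, \<open>lyapunov m y \<ge> 0\<close> says that the
  pairing of \<open>x\<close> with \<open>J y\<close> is at most \<open>(norm m)\<^sup>2\<close>. If
  \<open>x\<close> and \<open>y\<close> were \<open>e\<close> apart, uniform convexity would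
  therefore force \<open>lyapunov x y \<ge> 2 * \<delta>\<close>.\<close>

lemma lyapunov_small_imp_close:
  fixes R :: real
  assumes us: "uniformly_smooth TYPE('a::real_normed_vector)" and uc: "uniformly_convex TYPE('a)"
    and e: "e > 0"
  obtains \<delta> where "\<delta> > 0" and "\<And>x y :: 'a. norm x \<le> R \<Longrightarrow> norm y \<le> R \<Longrightarrow> lyapunov x y < \<delta> \<Longrightarrow>
    norm (x - y) < e"
proof -
  obtain \<delta> where \<delta>: "\<delta> > 0" and mid: "\<And>x y :: 'a. norm x \<le> max R 1 \<Longrightarrow> norm y \<le> max R 1 \<Longrightarrow>
    norm (x - y) \<ge> e \<Longrightarrow> (norm ((x + y) /\<^sub>R 2))\<^sup>2 \<le> ((norm x)\<^sup>2 + (norm y)\<^sup>2) / 2 - \<delta>"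
    using uniformly_convex_norm_square[OF uc e, of "max R 1"] by (metis less_max_iff_disj zero_less_one)
  have "norm (x - y) < e" if "norm x \<le> R" "norm y \<le> R" "lyapunov x y < \<delta>" for x y :: 'a
  proof (rule ccontr)
    assume "\<not> norm (x - y) < e"
    define m where "m = (x + y) /\<^sub>R 2"
    have "(norm m)\<^sup>2 \<le> ((norm x)\<^sup>2 + (norm y)\<^sup>2) / 2 - \<delta>"
      unfolding m_def using that \<open>\<not> norm (x - y) < e\<close> by (intro mid) auto
    moreover have "blinfun_apply (duality_map y) m = (blinfun_apply (duality_map y) x + (norm y)\<^sup>2) / 2"
      by (simp add: m_def blinfun.add_right blinfun.scaleR_right duality_map_self[OF us])
    then have "blinfun_apply (duality_map y) x \<le> (norm m)\<^sup>2"
      using lyapunov_nonneg[OF us, of m y] by (simp add: lyapunov_def field_simps)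
    ultimately show False using that \<delta> by (simp add: lyapunov_def field_simps)
  qed
  then show ?thesis using \<delta> that by blast
qed

lemma lyapunov_eq_0D:
  fixes x y :: "'a::real_normed_vector"
  assumes us: "uniformly_smooth TYPE('a)" and uc: "uniformly_convex TYPE('a)"
    and "lyapunov x y \<le> 0"
  shows "x = y"
proof (rule ccontr)
  assume "x \<noteq> y"
  then obtain \<delta> where "\<delta> > 0" "\<And>u v :: 'a. norm u \<le> max (norm x) (norm y) \<Longrightarrow>
      norm v \<le> max (norm x) (norm y) \<Longrightarrow> lyapunov u v < \<delta> \<Longrightarrow> norm (u - v) < norm (x - y)"
    using lyapunov_small_imp_close[OF us uc, of "norm (x - y)"] by (metis right_minus_eq zero_less_norm_iff)
  from this(2)[of x y] this(1) assms(3) show False by simp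
qed

text \<open>Boundedness of \<open>y\<close> is not assumed: once
  \<open>lyapunov (x n) (y n) \<le> 1\<close>, the norms differ by at most 1, whence the radius
  \<open>K + 1\<close>.\<close>

lemma lyapunov_tendsto_0:
  fixes x y :: "nat \<Rightarrow> 'a::real_normed_vector"
  assumes us: "uniformly_smooth TYPE('a)" and uc: "uniformly_convex TYPE('a)"
    and x: "Bseq x" and lim: "(\<lambda>n. lyapunov (x n) (y n)) \<longlonglongrightarrow> 0"
  shows "(\<lambda>n. x n - y n) \<longlonglongrightarrow> 0"
proof -
  obtain K where K: "\<And>n. norm (x n) \<le> K" using x by (auto simp: Bseq_def)
  show ?thesis
  proof (rule tendstoI)
    fix e :: real assume "e > 0"
    then obtain \<delta> where \<delta>: "\<delta> > 0" "\<And>u v :: 'a. norm u \<le> K + 1 \<Longrightarrow> norm v \<le> K + 1 \<Longrightarrow>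
        lyapunov u v < \<delta> \<Longrightarrow> norm (u - v) < e"
      using lyapunov_small_imp_close[OF us uc] by blast
    have "\<forall>\<^sub>F n in sequentially. lyapunov (x n) (y n) < min \<delta> 1"
      using lim \<delta>(1) by (intro order_tendstoD) auto
    then show "\<forall>\<^sub>F n in sequentially. dist (x n - y n) 0 < e"
    proof eventually_elim
      case (elim n)
      have "(norm (x n) - norm (y n))\<^sup>2 \<le> 1"
        using lyapunov_lower[OF us, of "x n" "y n"] elim by simp
      then have "\<bar>norm (x n) - norm (y n)\<bar> \<le> 1" by (simp add: abs_square_le_1)
      then have "norm (y n) \<le> K + 1" using K[of n] by simp
      then show ?case using \<delta>(2)[of "x n" "y n"] K[of n] elim by simp
    qed
  qed
qed

section \<open>Minimisers of strongly convex functionals and generalized projections\<close>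

text \<open>Compare \<open>p\<close> with \<open>p + t (y - p)\<close>, divide by \<open>t\<close>
  and let \<open>t\<close> tend to \<open>0\<close> from the right; the squared norm contributes
  twice the pairing of \<open>y - p\<close> with \<open>J p\<close>.\<close>

lemma minimizer_variational_inequality:
  fixes S :: "'a::real_normed_vector set" and g :: "'a \<Rightarrow> real" and f :: "'a \<Rightarrow>\<^sub>L real"
  assumes us: "uniformly_smooth TYPE('a)" and g: "convex_on S g" and p: "p \<in> S"
    and min: "\<And>y. y \<in> S \<Longrightarrow> g p + (norm p)\<^sup>2 - 2 * blinfun_apply f p \<le> g y + (norm y)\<^sup>2 - 2 * blinfun_apply f y"
    and y: "y \<in> S"
  shows "g p + 2 * blinfun_apply (f - duality_map p) (y - p) \<le> g y"
proof -
  have "g p - g y + 2 * blinfun_apply f (y - p) \<le> 2 * blinfun_apply (duality_map p) (y - p)"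
  proof (rule tendsto_le[OF _ norm_square_directional_derivative[OF us] tendsto_const])
    have "g p - g y + 2 * blinfun_apply f (y - p) \<le> ((norm (p + t *\<^sub>R (y - p)))\<^sup>2 - (norm p)\<^sup>2) / t"
      if t: "0 < t" "t < 1" for t
    proof -
      have eq: "p + t *\<^sub>R (y - p) = (1 - t) *\<^sub>R p + t *\<^sub>R y" by (simp add: algebra_simps)
      have "p + t *\<^sub>R (y - p) \<in> S"
        unfolding eq using convex_on_imp_convex[OF g] p y t by (auto simp: convex_alt)
      then have "g p + (norm p)\<^sup>2 - 2 * blinfun_apply f p \<le>
          g (p + t *\<^sub>R (y - p)) + (norm (p + t *\<^sub>R (y - p)))\<^sup>2 - 2 * blinfun_apply f (p + t *\<^sub>R (y - p))"
        by (rule min)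
      moreover have "g (p + t *\<^sub>R (y - p)) \<le> (1 - t) * g p + t * g y"
        unfolding eq using convex_onD[OF g, of t p y] p y t by simp
      moreover have "blinfun_apply f (p + t *\<^sub>R (y - p)) = blinfun_apply f p + t * blinfun_apply f (y - p)"
        by (simp add: blinfun.add_right blinfun.scaleR_right)
      ultimately have "(g p - g y + 2 * blinfun_apply f (y - p)) * t \<le> (norm (p + t *\<^sub>R (y - p)))\<^sup>2 - (norm p)\<^sup>2"
        by (simp add: algebra_simps)
      then show ?thesis using t by (simp add: pos_le_divide_eq)
    qed
    then show "\<forall>\<^sub>F t in at_right 0. g p - g y + 2 * blinfun_apply f (y - p) \<le>
        ((norm (p + t *\<^sub>R (y - p)))\<^sup>2 - (norm p)\<^sup>2) / t"
      by (auto intro!: eventually_at_rightI[of 0 1])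
  qed simp
  then show ?thesis by (simp add: blinfun.diff_left)
qed

text \<open>If two nearly minimal points were \<open>e\<close> apart, uniform convexity would push
  the value at their midpoint below the infimum; so a minimising sequence is Cauchy. The assumption
  \<open>lsc\<close> expresses lower semicontinuity of the extension of \<open>g\<close> by
  \<infinity> outside \<open>S\<close>, which admits a domain \<open>S\<close> that is not
  closed.\<close>

lemma minimizer_exists:
  fixes S :: "'a::banach set" and g :: "'a \<Rightarrow> real" and f :: "'a \<Rightarrow>\<^sub>L real"
  assumes uc: "uniformly_convex TYPE('a)" and g: "convex_on S g" and ne: "S \<noteq> {}"
    and lower: "\<And>y. y \<in> S \<Longrightarrow> c \<le> g y"
    and lsc: "\<And>z w L. (\<And>n. z n \<in> S) \<Longrightarrow> z \<longlonglongrightarrow> w \<Longrightarrow> (\<lambda>n. g (z n)) \<longlonglongrightarrow> L \<Longrightarrow> w \<in> S \<and> g w \<le> L"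
  obtains p where "p \<in> S"
    and "\<And>y. y \<in> S \<Longrightarrow> g p + (norm p)\<^sup>2 - 2 * blinfun_apply f p \<le> g y + (norm y)\<^sup>2 - 2 * blinfun_apply f y"
proof -
  define G where "G y = g y + (norm y)\<^sup>2 - 2 * blinfun_apply f y" for y
  define I where "I = (INF y\<in>S. G y)"
  have f_le: "blinfun_apply f y \<le> norm f * norm y" for y
    using norm_blinfun[of f y] by simp
  \<comment> \<open>Completing the square in \<open>norm y\<close> bounds \<open>G\<close> from
    below and its sublevel sets in norm.\<close>
  have G_lower: "c + (norm y - norm f)\<^sup>2 - (norm f)\<^sup>2 \<le> G y" if "y \<in> S" for y
    using lower[OF that] f_le[of y] by (simp add: G_def power2_diff algebra_simps)
  have "c - (norm f)\<^sup>2 \<le> G y" if "y \<in> S" for y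
    using G_lower[OF that] zero_le_power2[of "norm y - norm f"] by linarith
  then have bdd: "bdd_below (G ` S)" by (rule bdd_belowI2)
  have I_le: "I \<le> G y" if "y \<in> S" for y
    unfolding I_def using that bdd by (rule cINF_lower[rotated])
  have "\<exists>y\<in>S. G y < I + 1 / real (Suc n)" for n
    using cINF_less_iff[OF ne bdd, of "I + 1 / real (Suc n)"] by (simp add: I_def)
  then obtain z where z: "\<And>n. z n \<in> S" "\<And>n. G (z n) < I + 1 / real (Suc n)" by metis
  have lim: "(\<lambda>n. G (z n)) \<longlonglongrightarrow> I"
  proof (rule tendsto_sandwich[OF _ _ tendsto_const])
    show "(\<lambda>n. I + 1 / real (Suc n)) \<longlonglongrightarrow> I"
      using tendsto_add[OF tendsto_const[of I] LIMSEQ_Suc[OF lim_1_over_n]] by simp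
  qed (intro always_eventually allI I_le[OF z(1)] less_imp_le[OF z(2)])+
  \<comment> \<open>Solves \<open>G_lower\<close> for \<open>norm y\<close> at values of at most
    \<open>I + 1\<close>; the last summand makes the radius positive.\<close>
  define R where "R = norm f + sqrt (I + 1 - c + (norm f)\<^sup>2) + 1"
  have sq: "(norm (z n) - norm f)\<^sup>2 \<le> I + 1 - c + (norm f)\<^sup>2" for n
  proof -
    have "1 / real (Suc n) \<le> 1" by simp
    then show ?thesis using G_lower[OF z(1)[of n]] z(2)[of n] by linarith
  qed
  have zR: "norm (z n) \<le> R" for n
    using real_le_rsqrt[OF sq[of n]] by (simp add: R_def)
  have "0 \<le> I + 1 - c + (norm f)\<^sup>2"
    using zero_le_power2 sq[of 0] by (rule order_trans)
  then have R: "R > 0" by (auto simp: R_def intro: add_nonneg_pos)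
  have "Cauchy z"
  proof (rule metric_CauchyI)
    fix e :: real assume "e > 0"
    then obtain \<delta> where \<delta>: "\<delta> > 0" and mid: "\<And>x y :: 'a. norm x \<le> R \<Longrightarrow> norm y \<le> R \<Longrightarrow> norm (x - y) \<ge> e \<Longrightarrow>
        (norm ((x + y) /\<^sub>R 2))\<^sup>2 \<le> ((norm x)\<^sup>2 + (norm y)\<^sup>2) / 2 - \<delta>"
      using uniformly_convex_norm_square[OF uc _ R] by metis
    obtain M where M: "\<And>n. n \<ge> M \<Longrightarrow> G (z n) < I + \<delta>"
      using order_tendstoD(2)[OF lim, of "I + \<delta>"] \<delta> by (auto simp: eventually_sequentially)
    have "dist (z i) (z j) < e" if "i \<ge> M" "j \<ge> M" for i j
    proof (rule ccontr)
      assume "\<not> dist (z i) (z j) < e"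
      define m where "m = (z i + z j) /\<^sub>R 2"
      have m_eq: "m = (1 - 1/2) *\<^sub>R z i + (1/2) *\<^sub>R z j" by (simp add: m_def scaleR_add_right)
      have "m \<in> S"
        unfolding m_eq using convex_on_imp_convex[OF g] z(1)[of i] z(1)[of j]
        by (intro convexD_alt) auto
      then have "I \<le> G m" by (rule I_le)
      moreover have "(norm m)\<^sup>2 \<le> ((norm (z i))\<^sup>2 + (norm (z j))\<^sup>2) / 2 - \<delta>"
        unfolding m_def using \<open>\<not> dist (z i) (z j) < e\<close> zR by (intro mid) (auto simp: dist_norm)
      moreover have "g m \<le> (1 - 1/2) * g (z i) + 1/2 * g (z j)"
        unfolding m_eq using z(1) by (intro convex_onD[OF g]) auto
      moreover have "blinfun_apply f m = (blinfun_apply f (z i) + blinfun_apply f (z j)) / 2"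
        by (simp add: m_def blinfun.add_right blinfun.scaleR_right)
      ultimately have "2 * I \<le> G (z i) + G (z j) - 2 * \<delta>"
        by (simp add: G_def field_simps)
      then show False using M[OF that(1)] M[OF that(2)] by simp
    qed
    then show "\<exists>M. \<forall>m\<ge>M. \<forall>n\<ge>M. dist (z m) (z n) < e" by blast
  qed
  then obtain p where p: "z \<longlonglongrightarrow> p" using Cauchy_convergent convergent_def by blast
  have "(\<lambda>n. G (z n) - (norm (z n))\<^sup>2 + 2 * blinfun_apply f (z n)) \<longlonglongrightarrow> I - (norm p)\<^sup>2 + 2 * blinfun_apply f p"
    by (intro tendsto_intros lim p)
  then have "(\<lambda>n. g (z n)) \<longlonglongrightarrow> I - (norm p)\<^sup>2 + 2 * blinfun_apply f p"
    by (simp add: G_def)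
  from lsc[OF z(1) p this] have "p \<in> S" "G p \<le> I" by (auto simp: G_def)
  then show ?thesis using that I_le unfolding G_def by (meson order_trans)
qed

text \<open>Up to the constant \<open>(norm x)\<^sup>2\<close>, \<open>lyapunov y x\<close> is the
  functional of \<open>minimizer_exists\<close> with \<open>g = 0\<close> and
  \<open>f = J x\<close>. The variational inequality makes the pairing in
  \<open>lyapunov_three_point\<close> nonpositive, and the resulting inequality forces
  \<open>lyapunov w p \<le> 0\<close> for any other minimiser \<open>w\<close>.\<close>

lemma gen_proj_properties:
  fixes D :: "'a::banach set"
  assumes us: "uniformly_smooth TYPE('a)" and uc: "uniformly_convex TYPE('a)"
    and D: "D \<noteq> {}" "closed D" "convex D"
  shows gen_proj_in: "gen_proj D x \<in> D"
    and gen_proj_three_point: "\<And>y. y \<in> D \<Longrightarrow> lyapunov y (gen_proj D x) + lyapunov (gen_proj D x) x \<le> lyapunov y x"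
    and gen_proj_eqI: "\<And>p. p \<in> D \<Longrightarrow> (\<And>y. y \<in> D \<Longrightarrow> lyapunov p x \<le> lyapunov y x) \<Longrightarrow> gen_proj D x = p"
proof -
  have cvx: "convex_on D (\<lambda>_. 0)" using D(3) by (simp add: convex_on_def)
  obtain p where p: "p \<in> D"
    and min: "\<And>y. y \<in> D \<Longrightarrow> 0 + (norm p)\<^sup>2 - 2 * blinfun_apply (duality_map x) p \<le>
      0 + (norm y)\<^sup>2 - 2 * blinfun_apply (duality_map x) y"
  proof (rule minimizer_exists[OF uc cvx D(1), where c = 0 and f = "duality_map x"])
    show "w \<in> D \<and> 0 \<le> L" if "\<And>n. z n \<in> D" "z \<longlonglongrightarrow> w" "(\<lambda>n. 0) \<longlonglongrightarrow> L" for z w and L :: real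
      using closed_sequentially[OF D(2) that(1,2)] that(3) by (simp add: LIMSEQ_const_iff)
  qed (use that in simp_all)
  have three: "lyapunov y p + lyapunov p x \<le> lyapunov y x" if "y \<in> D" for y
    using minimizer_variational_inequality[OF us cvx p min that]
    by (simp add: lyapunov_three_point[OF us])
  have uniq: "w = p" if "w \<in> D" "\<And>y. y \<in> D \<Longrightarrow> lyapunov w x \<le> lyapunov y x" for w
    using three[OF that(1)] that(2)[OF p] by (intro lyapunov_eq_0D[OF us uc]) simp
  have p_le: "lyapunov p x \<le> lyapunov y x" if "y \<in> D" for y
    using three[OF that] lyapunov_nonneg[OF us, of y p] by simp
  have eq: "gen_proj D x = p"
    unfolding gen_proj_def
  proof (rule the_equality)
    show "is_arg_min (\<lambda>y. lyapunov y x) (\<lambda>y. y \<in> D) p"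
      using p p_le by (simp add: is_arg_min_linorder)
    show "w = p" if "is_arg_min (\<lambda>y. lyapunov y x) (\<lambda>y. y \<in> D) w" for w
      using that by (intro uniq) (simp_all add: is_arg_min_linorder)
  qed
  show "gen_proj D x \<in> D" unfolding eq by (rule p)
  show "lyapunov y (gen_proj D x) + lyapunov (gen_proj D x) x \<le> lyapunov y x" if "y \<in> D" for y
    unfolding eq using that by (rule three)
  show "gen_proj D x = w" if "w \<in> D" "\<And>y. y \<in> D \<Longrightarrow> lyapunov w x \<le> lyapunov y x" for w
    unfolding eq using uniq[OF that] by simp
qed

section \<open>Lower semicontinuity, subgradients and resolvents\<close>

lemma lsc_fun_sequentially:
  fixes h :: "'a::first_countable_topology \<Rightarrow> ereal"
  assumes h: "lsc_fun h" and z: "z \<longlonglongrightarrow> w" and L: "L \<longlonglongrightarrow> l"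
    and le: "\<forall>\<^sub>F n in sequentially. h (z n) \<le> L n"
  shows "h w \<le> l"
proof (rule dense_le)
  fix c assume c: "c < h w"
  then have "c < Liminf (at w) h"
    using h by (auto simp: lsc_fun_def intro: less_le_trans)
  then have "\<forall>\<^sub>F y in at w. c < h y"
    by (rule less_LiminfD)
  \<comment> \<open>The limit inferior ignores the point \<open>w\<close> itself, which the sequence
    may visit; \<open>c < h w\<close> fills the gap.\<close>
  then have "\<forall>\<^sub>F y in nhds w. c < h y"
    using c by (simp add: eventually_nhds_conv_at)
  then have "\<forall>\<^sub>F n in sequentially. c < h (z n)"
    using z by (rule eventually_compose_filterlim)
  with le have "\<forall>\<^sub>F n in sequentially. c \<le> L n"
    by eventually_elim simp
  then show "c \<le> l"
    by (rule tendsto_lowerbound[OF L]) simp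
qed

lemma subdifferential_finite:
  assumes "proper_fun h" "f \<in> subdifferential h q"
  shows "\<bar>h q\<bar> \<noteq> \<infinity>"
proof -
  obtain y where "h y \<noteq> \<infinity>" using assms by (auto simp: proper_fun_def)
  moreover have "h q + ereal (blinfun_apply f (y - q)) \<le> h y"
    using assms by (auto simp: subdifferential_def)
  ultimately show ?thesis using assms(1) by (auto simp: proper_fun_def)
qed

text \<open>The resolvent is the minimiser of \<open>2 r h + (norm y)\<^sup>2 - 2 (J x) y\<close>
  over the domain of \<open>h\<close>; its variational inequality divided by \<open>2 r\<close> is
  the subgradient inequality. A minimiser of \<open>h\<close> supplies the lower bound needed for
  existence.\<close>

lemma resolvent_in_subdifferential:
  fixes h :: "'a::banach \<Rightarrow> ereal"
  assumes us: "uniformly_smooth TYPE('a)" and uc: "uniformly_convex TYPE('a)"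
    and h: "proper_fun h" "convex_fun h" "lsc_fun h" and ne: "argmin_set h \<noteq> {}" and r: "r > 0"
  shows "(duality_map x - duality_map (resolvent r h x)) /\<^sub>R r \<in> subdifferential h (resolvent r h x)"
proof -
  define S where "S = {y. h y \<noteq> \<infinity>}"
  define g where "g y = 2 * r * real_of_ereal (h y)" for y
  have not_MInf: "h y \<noteq> - \<infinity>" for y using h(1) by (simp add: proper_fun_def)
  have hS: "h y = ereal (real_of_ereal (h y))" if "y \<in> S" for y
    using that not_MInf[of y] by (cases "h y") (auto simp: S_def)
  obtain v where v: "\<And>y. h v \<le> h y"
    using ne by (auto simp: argmin_set_def is_arg_min_linorder)
  have ne: "S \<noteq> {}" using h(1) by (auto simp: S_def proper_fun_def)
  then have vS: "v \<in> S" using v by (force simp: S_def)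
  have convex: "(1 - t) *\<^sub>R y + t *\<^sub>R z \<in> S \<and>
      real_of_ereal (h ((1 - t) *\<^sub>R y + t *\<^sub>R z)) \<le> (1 - t) * real_of_ereal (h y) + t * real_of_ereal (h z)"
    if "0 < t" "t < 1" "y \<in> S" "z \<in> S" for t y z
  proof -
    have "h ((1 - t) *\<^sub>R y + t *\<^sub>R z) \<le> ereal (1 - t) * h y + ereal t * h z"
      using h(2) that by (simp add: convex_fun_def)
    also have "\<dots> = ereal ((1 - t) * real_of_ereal (h y) + t * real_of_ereal (h z))"
      by (subst (1) hS[OF that(3)], subst (1) hS[OF that(4)]) simp
    finally have le: "h ((1 - t) *\<^sub>R y + t *\<^sub>R z) \<le> ereal ((1 - t) * real_of_ereal (h y) + t * real_of_ereal (h z))" .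
    then have S: "(1 - t) *\<^sub>R y + t *\<^sub>R z \<in> S" by (auto simp: S_def)
    with le show ?thesis by (subst (asm) hS[OF S]) simp
  qed
  have "convex_on S (\<lambda>y. real_of_ereal (h y))"
  proof (rule convex_onI)
    show "convex S"
      unfolding convex_alt
    proof (intro ballI allI impI)
      fix y z and t :: real assume "y \<in> S" "z \<in> S" "0 \<le> t \<and> t \<le> 1"
      then show "(1 - t) *\<^sub>R y + t *\<^sub>R z \<in> S"
        using convex[of t y z] by (cases "t = 0 \<or> t = 1") auto
    qed
  qed (use convex in blast)
  then have cvx: "convex_on S g"
    unfolding g_def using r by (intro convex_on_cmul) auto
  have lower: "2 * r * real_of_ereal (h v) \<le> g y" if "y \<in> S" for y
    using v[of y] r hS[OF that] hS[OF vS] by (simp add: g_def) (metis ereal_less_eq(3))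
  have lsc: "w \<in> S \<and> g w \<le> L" if z: "\<And>n. z n \<in> S" "z \<longlonglongrightarrow> w" "(\<lambda>n. g (z n)) \<longlonglongrightarrow> L" for z w L
  proof -
    have "(\<lambda>n. ereal (g (z n) / (2 * r))) \<longlonglongrightarrow> ereal (L / (2 * r))"
      using r by (intro tendsto_intros z(3)) auto
    moreover have "h (z n) \<le> ereal (g (z n) / (2 * r))" for n
      using r hS[OF z(1)[of n]] by (simp add: g_def)
    ultimately have le: "h w \<le> ereal (L / (2 * r))"
      by (intro lsc_fun_sequentially[OF h(3) z(2)] always_eventually) blast+
    then have w: "w \<in> S" by (auto simp: S_def)
    have "real_of_ereal (h w) \<le> L / (2 * r)"
      using le by (subst (asm) hS[OF w]) simp
    then show ?thesis using r w by (simp add: g_def pos_le_divide_eq mult.commute)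
  qed
  obtain p where p: "p \<in> S" and min: "\<And>y. y \<in> S \<Longrightarrow> g p + (norm p)\<^sup>2 - 2 * blinfun_apply (duality_map x) p \<le>
      g y + (norm y)\<^sup>2 - 2 * blinfun_apply (duality_map x) y"
    by (rule minimizer_exists[OF uc cvx ne lower, where f = "duality_map x"]) (assumption | rule lsc | rule that | simp)+
  have sub: "(duality_map x - duality_map p) /\<^sub>R r \<in> subdifferential h p"
    unfolding subdifferential_def
  proof (intro CollectI allI)
    fix y
    show "h p + ereal (blinfun_apply ((duality_map x - duality_map p) /\<^sub>R r) (y - p)) \<le> h y"
    proof (cases "y \<in> S")
      case True
      have "2 * r * real_of_ereal (h p) + 2 * blinfun_apply (duality_map x - duality_map p) (y - p) \<le>
          2 * r * real_of_ereal (h y)"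
        using minimizer_variational_inequality[OF us cvx p min True] by (simp add: g_def)
      then have "real_of_ereal (h p) + blinfun_apply (duality_map x - duality_map p) (y - p) / r \<le> real_of_ereal (h y)"
        using r by (simp add: field_simps)
      then show ?thesis
        by (subst hS[OF p], subst hS[OF True]) (simp add: blinfun.scaleR_left divide_inverse mult.commute)
    qed (auto simp: S_def)
  qed
  \<comment> \<open>Monotonicity: adding the subgradient inequalities at \<open>p\<close> and
    \<open>q\<close> cancels \<open>h\<close> and \<open>J x\<close>, and leaves the pairing of
    \<open>p - q\<close> with \<open>J p - J q\<close>, which is half of
    \<open>lyapunov q p + lyapunov p q\<close>.\<close>
  have "q = p" if q: "(duality_map x - duality_map q) /\<^sub>R r \<in> subdifferential h q" for q
  proof -
    have qS: "q \<in> S" using subdifferential_finite[OF h(1) q] by (auto simp: S_def)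
    have 1: "real_of_ereal (h q) + blinfun_apply (duality_map x - duality_map q) (p - q) / r \<le> real_of_ereal (h p)"
    proof -
      have "h q + ereal (blinfun_apply ((duality_map x - duality_map q) /\<^sub>R r) (p - q)) \<le> h p"
        using q by (simp add: subdifferential_def)
      then show ?thesis
        by (subst (asm) hS[OF qS], subst (asm) hS[OF p]) (simp add: blinfun.scaleR_left divide_inverse mult.commute)
    qed
    have 2: "real_of_ereal (h p) + blinfun_apply (duality_map x - duality_map p) (q - p) / r \<le> real_of_ereal (h q)"
    proof -
      have "h p + ereal (blinfun_apply ((duality_map x - duality_map p) /\<^sub>R r) (q - p)) \<le> h q"
        using sub by (simp add: subdifferential_def)
      then show ?thesis
        by (subst (asm) hS[OF p], subst (asm) hS[OF qS]) (simp add: blinfun.scaleR_left divide_inverse mult.commute)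
    qed
    have "(blinfun_apply (duality_map x - duality_map q) (p - q) + blinfun_apply (duality_map x - duality_map p) (q - p)) / r \<le> 0"
      using 1 2 by (simp add: add_divide_distrib)
    then have "blinfun_apply (duality_map x - duality_map q) (p - q) + blinfun_apply (duality_map x - duality_map p) (q - p) \<le> 0"
      using r by (simp add: divide_le_0_iff)
    then have "lyapunov q p + lyapunov p q \<le> 0"
      by (simp add: lyapunov_def blinfun.diff_left blinfun.diff_right duality_map_self[OF us])
    then show ?thesis
      using lyapunov_nonneg[OF us, of p q] by (intro lyapunov_eq_0D[OF us uc]) simp
  qed
  then have "resolvent r h x = p"
    unfolding resolvent_def using sub by (intro the_equality)
  then show ?thesis using sub by simp
qed

text \<open>Testing the subgradient at \<open>q\<close> with a minimiser \<open>v\<close>, where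
  \<open>h v \<le> h q\<close>, makes the pairing in \<open>lyapunov_three_point\<close>
  nonpositive.\<close>

lemma resolvent_three_point:
  fixes h :: "'a::banach \<Rightarrow> ereal"
  assumes us: "uniformly_smooth TYPE('a)" and h: "proper_fun h" and r: "r > 0"
    and q: "(duality_map x - duality_map q) /\<^sub>R r \<in> subdifferential h q" and v: "v \<in> argmin_set h"
  shows "lyapunov v q + lyapunov q x \<le> lyapunov v x"
proof -
  obtain b where b: "h q = ereal b"
    using subdifferential_finite[OF h q] by (cases "h q") auto
  have "h q + ereal (blinfun_apply ((duality_map x - duality_map q) /\<^sub>R r) (v - q)) \<le> h v"
    using q by (simp add: subdifferential_def)
  also have "h v \<le> h q" using v by (simp add: argmin_set_def is_arg_min_linorder)
  finally have "blinfun_apply (duality_map x - duality_map q) (v - q) \<le> 0"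
    using r by (simp add: b blinfun.scaleR_left mult_le_0_iff)
  then show ?thesis by (simp add: lyapunov_three_point[OF us])
qed

section \<open>Ingredients of the iteration\<close>

text \<open>The terms \<open>(norm v)\<^sup>2\<close> cancel, so the condition is affine in
  \<open>v\<close>.\<close>

lemma lyapunov_le_halfspace:
  shows closed_lyapunov_le: "closed {v. lyapunov v a \<le> lyapunov v b}"
    and convex_lyapunov_le: "convex {v. lyapunov v a \<le> lyapunov v b}"
proof -
  define c where "c = (norm b)\<^sup>2 - (norm a)\<^sup>2"
  define f where "f = 2 *\<^sub>R (duality_map b - duality_map a)"
  have eq: "{v. lyapunov v a \<le> lyapunov v b} = {v. blinfun_apply f v \<le> c}"
    by (auto simp: lyapunov_def c_def f_def blinfun.diff_left blinfun.scaleR_left algebra_simps)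
  show "closed {v. lyapunov v a \<le> lyapunov v b}"
    unfolding eq by (intro closed_Collect_le continuous_intros)
  have "convex (blinfun_apply f -` {..c})"
    by (intro convex_linear_vimage blinfun.bounded_linear_right bounded_linear.linear convex_real_interval)
  then show "convex {v. lyapunov v a \<le> lyapunov v b}"
    unfolding eq by (simp add: vimage_def)
qed

lemma tendsto_lyapunov:
  assumes "(x \<longlongrightarrow> w) F"
  shows "((\<lambda>n. lyapunov (x n) y) \<longlongrightarrow> lyapunov w y) F"
  unfolding lyapunov_def by (intro tendsto_intros assms)

text \<open>\<open>J (x n) - J (q n)\<close> is only known to tend to \<open>0\<close> weak*, so
  \<open>y - q n\<close> is split into the fixed vector \<open>y - w\<close> and
  \<open>w - q n\<close>, which tends to \<open>0\<close> in norm while the functionals stay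
  bounded. Division by \<open>r n \<ge> a\<close> preserves the limit \<open>0\<close>, and lower
  semicontinuity does the rest.\<close>

lemma minimizer_of_subgradient_limit:
  fixes h :: "'a::banach \<Rightarrow> ereal" and x q :: "nat \<Rightarrow> 'a"
  assumes us: "uniformly_smooth TYPE('a)" and h: "lsc_fun h"
    and x: "x \<longlonglongrightarrow> w" and q: "q \<longlonglongrightarrow> w" and a: "a > 0" and r: "\<And>n. r n \<ge> a"
    and sub: "\<And>n. (duality_map (x n) - duality_map (q n)) /\<^sub>R r n \<in> subdifferential h (q n)"
  shows "w \<in> argmin_set h"
proof -
  have "h w \<le> h y" for y
  proof -
    define e where "e n = blinfun_apply (duality_map (x n) - duality_map (q n)) (y - q n)" for n
    have wlim: "(\<lambda>n. blinfun_apply (duality_map (x n) - duality_map (q n)) (y - w)) \<longlonglongrightarrow> 0"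
      using tendsto_diff[OF duality_map_tendsto[OF us x, of "y - w"] duality_map_tendsto[OF us q, of "y - w"]]
      by (simp add: blinfun.diff_left)
    have "(\<lambda>n. blinfun_apply (duality_map (x n) - duality_map (q n)) (w - q n)) \<longlonglongrightarrow> 0"
    proof (rule Lim_null_comparison)
      show "(\<lambda>n. (norm (x n) + norm (q n)) * norm (w - q n)) \<longlonglongrightarrow> 0"
        by (rule tendsto_eq_intros x q refl)+ simp
      have "norm (blinfun_apply (duality_map (x n) - duality_map (q n)) (w - q n)) \<le>
          (norm (x n) + norm (q n)) * norm (w - q n)" for n
      proof -
        have "norm (duality_map (x n) - duality_map (q n)) \<le> norm (x n) + norm (q n)"
          using norm_triangle_ineq4[of "duality_map (x n)" "duality_map (q n)"]
          by (simp add: norm_duality_map[OF us])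
        then show ?thesis
          by (intro order_trans[OF norm_blinfun] mult_right_mono) auto
      qed
      then show "\<forall>\<^sub>F n in sequentially. norm (blinfun_apply (duality_map (x n) - duality_map (q n)) (w - q n)) \<le>
          (norm (x n) + norm (q n)) * norm (w - q n)"
        by simp
    qed
    from tendsto_add[OF wlim this] have e: "e \<longlonglongrightarrow> 0"
      by (simp add: e_def[abs_def] flip: blinfun.add_right)
    have er: "(\<lambda>n. e n / r n) \<longlonglongrightarrow> 0"
    proof (rule Lim_null_comparison)
      have "norm (e n / r n) \<le> \<bar>e n\<bar> / a" for n
        using r[of n] a by (simp add: frac_le)
      then show "\<forall>\<^sub>F n in sequentially. norm (e n / r n) \<le> \<bar>e n\<bar> / a"
        by simp
      show "(\<lambda>n. \<bar>e n\<bar> / a) \<longlonglongrightarrow> 0"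
        using tendsto_divide[OF tendsto_rabs[OF e] tendsto_const[of a]] a by simp
    qed
    have le: "h (q n) + ereal (e n / r n) \<le> h y" for n
      using sub[of n] by (simp add: subdifferential_def e_def blinfun.scaleR_left divide_inverse mult.commute)
    show ?thesis
    proof (rule lsc_fun_sequentially[OF h q])
      show "(\<lambda>n. h y + ereal (- (e n / r n))) \<longlonglongrightarrow> h y"
        using tendsto_add_ereal_general[of "h y" 0 "\<lambda>n. h y" sequentially "\<lambda>n. ereal (- (e n / r n))"]
          tendsto_ereal[OF tendsto_minus[OF er]]
        by (simp add: zero_ereal_def)
      have "h (q n) \<le> h y + ereal (- (e n / r n))" for n
        using le[of n] by (cases "h (q n)"; cases "h y") auto
      then show "\<forall>\<^sub>F n in sequentially. h (q n) \<le> h y + ereal (- (e n / r n))"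
        by simp
    qed
  qed
  then show ?thesis by (simp add: argmin_set_def is_arg_min_linorder)
qed

section \<open>Convergence of the shrinking projection iteration\<close>

theorem corollary4p3:
  fixes h :: "nat \<Rightarrow> 'a::banach \<Rightarrow> ereal"
    and B3 :: "'a set"
    and \<rho> :: "nat \<Rightarrow> nat"
    and r :: "nat \<Rightarrow> real" and a :: real
    and x q :: "nat \<Rightarrow> 'a" and x0 :: 'a
    and C :: "nat \<Rightarrow> 'a set"
  assumes "uniformly_smooth TYPE('a)" and "uniformly_convex TYPE('a)"
    and "\<And>k. k \<ge> 1 \<Longrightarrow> proper_fun (h k)"
    and "\<And>k. k \<ge> 1 \<Longrightarrow> convex_fun (h k)"
    and "\<And>k. k \<ge> 1 \<Longrightarrow> lsc_fun (h k)"
    and "B3 = (\<Inter>k\<in>{1..}. argmin_set (h k))"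
    and "B3 \<noteq> {}" and "closed B3" and "convex B3"
    and "\<And>n. n \<ge> 1 \<Longrightarrow> \<rho> n \<ge> 1"
    and "\<And>k. k \<ge> 1 \<Longrightarrow> infinite {n. n \<ge> 1 \<and> \<rho> n = k}"
    and "a > 0" and "\<And>n. n \<ge> 1 \<Longrightarrow> r n \<ge> a"
    and "x 1 = x0" and "C 1 = UNIV"
    and "\<And>n. n \<ge> 1 \<Longrightarrow> q n = resolvent (r n) (h (\<rho> n)) (x n)"
    and "\<And>n. n \<ge> 1 \<Longrightarrow> C (Suc n) = {v \<in> C n. lyapunov v (q n) \<le> lyapunov v (x n)}"
    and "\<And>n. n \<ge> 1 \<Longrightarrow> x (Suc n) = gen_proj (C (Suc n)) x0"
  shows "x \<longlonglongrightarrow> gen_proj B3 x0"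
proof -
  note us = assms(1) and uc = assms(2) and proper = assms(3) and cvx = assms(4) and lsc = assms(5)
    and B3 = assms(6-9) and \<rho> = assms(10,11) and a = assms(12) and r = assms(13)
    and x1 = assms(14) and C1 = assms(15) and q = assms(16) and CSuc = assms(17) and xSuc = assms(18)
  have r_pos: "r n > 0" if "n \<ge> 1" for n
    using r[OF that] a by simp
  have sub: "(duality_map (x n) - duality_map (q n)) /\<^sub>R r n \<in> subdifferential (h (\<rho> n)) (q n)"
    if n: "n \<ge> 1" for n
  proof -
    have "argmin_set (h (\<rho> n)) \<noteq> {}" using B3(1,2) \<rho>(1)[OF n] by auto
    then show ?thesis
      using resolvent_in_subdifferential[OF us uc] proper cvx lsc \<rho>(1)[OF n] r_pos[OF n]
      by (simp add: q[OF n])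
  qed
  have three: "lyapunov v (q n) + lyapunov (q n) (x n) \<le> lyapunov v (x n)" if "n \<ge> 1" "v \<in> B3" for n v
    using that B3(1) \<rho>(1)[OF that(1)]
    by (intro resolvent_three_point[OF us proper[OF \<rho>(1)[OF that(1)]] r_pos sub]) auto
  have C: "closed (C n) \<and> convex (C n) \<and> B3 \<subseteq> C n" if "n \<ge> 1" for n
    using that
  proof (induction n rule: dec_induct)
    case base
    then show ?case using C1 by simp
  next
    case (step n)
    have "C (Suc n) = C n \<inter> {v. lyapunov v (q n) \<le> lyapunov v (x n)}"
      using CSuc[of n] step.hyps by auto
    moreover have "lyapunov v (q n) \<le> lyapunov v (x n)" if "v \<in> B3" for v
      using three[of n v] lyapunov_nonneg[OF us, of "q n" "x n"] step.hyps that by simp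
    ultimately show ?case
      using step.IH by (auto intro!: closed_Int convex_Int closed_lyapunov_le convex_lyapunov_le)
  qed
  then have C_ne: "C n \<noteq> {}" if "n \<ge> 1" for n
    using B3(2) that by blast
  note gp = gen_proj_in[OF us uc] gen_proj_three_point[OF us uc] gen_proj_eqI[OF us uc]
  \<comment> \<open>The recursion gives this from index 2 on; at index 1 the point \<open>x0\<close>
    is its own projection onto the whole space, since \<open>lyapunov x0 x0 = 0\<close>.\<close>
  have x_eq: "x n = gen_proj (C n) x0" if "n \<ge> 1" for n
  proof (cases "n = 1")
    case True
    have "gen_proj UNIV x0 = x0"
      using lyapunov_nonneg[OF us] by (intro gp(3)) (auto simp: lyapunov_self[OF us])
    then show ?thesis using True x1 C1 by simp
  next
    case False
    then show ?thesis using xSuc[of "n - 1"] that by simp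
  qed
  have xC: "x n \<in> C n" and proj: "\<And>v. v \<in> C n \<Longrightarrow> lyapunov v (x n) + lyapunov (x n) x0 \<le> lyapunov v x0"
    if "n \<ge> 1" for n
    using gp(1,2)[OF C_ne[OF that]] C[OF that] x_eq[OF that] by auto
  have C_mono: "C m \<subseteq> C n" if "1 \<le> n" "n \<le> m" for m n
    using that(2,1) by (induction m rule: dec_induct) (use CSuc in auto)
  \<comment> \<open>As \<open>x m\<close> lies in \<open>C m\<close> and hence in
    \<open>C n\<close>, it is an admissible point in the projection inequality for
    \<open>x n\<close>.\<close>
  have step: "lyapunov (x m) (x n) \<le> lyapunov (x m) x0 - lyapunov (x n) x0" if "1 \<le> n" "n \<le> m" for m n
    using proj[of n "x m"] xC[of m] C_mono[OF that] that by auto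
  have le: "lyapunov (x n) x0 \<le> lyapunov v x0" if "n \<ge> 1" "v \<in> B3" for n v
    using proj[OF that(1), of v] C[OF that(1)] that(2) lyapunov_nonneg[OF us, of v "x n"] by auto
  obtain u where u: "u \<in> B3" using B3(2) by auto
  define R where "R = norm x0 + sqrt (lyapunov u x0)"
  have R: "norm (x n) \<le> R" if "n \<ge> 1" for n
  proof -
    have "(norm (x n) - norm x0)\<^sup>2 \<le> lyapunov u x0"
      using lyapunov_lower[OF us, of "x n" x0] le[OF that u] by simp
    then have "norm (x n) - norm x0 \<le> sqrt (lyapunov u x0)" by (rule real_le_rsqrt)
    then show ?thesis by (simp add: R_def)
  qed
  \<comment> \<open>The iteration starts at index 1; the shift by \<open>Suc\<close> keeps the
    arbitrary value \<open>x 0\<close> out of the sequence.\<close>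
  have "incseq (\<lambda>n. lyapunov (x (Suc n)) x0)"
  proof (rule incseq_SucI)
    show "lyapunov (x (Suc n)) x0 \<le> lyapunov (x (Suc (Suc n))) x0" for n
      using step[of "Suc n" "Suc (Suc n)"] lyapunov_nonneg[OF us, of "x (Suc (Suc n))" "x (Suc n)"] by simp
  qed
  then obtain l where l: "(\<lambda>n. lyapunov (x (Suc n)) x0) \<longlonglongrightarrow> l"
  proof (rule incseq_convergent)
    show "\<forall>n. lyapunov (x (Suc n)) x0 \<le> lyapunov u x0" using le[OF _ u] by simp
  qed
  have "Cauchy (\<lambda>n. x (Suc n))"
  proof (rule CauchyI')
    fix e :: real assume "e > 0"
    then obtain \<delta> where \<delta>: "\<delta> > 0" "\<And>y z :: 'a. norm y \<le> R \<Longrightarrow> norm z \<le> R \<Longrightarrow> lyapunov y z < \<delta> \<Longrightarrow> norm (y - z) < e"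
      using lyapunov_small_imp_close[OF us uc] by blast
    obtain M where M: "\<And>m n. m \<ge> M \<Longrightarrow> n \<ge> M \<Longrightarrow> norm (lyapunov (x (Suc m)) x0 - lyapunov (x (Suc n)) x0) < \<delta>"
      using CauchyD[OF LIMSEQ_imp_Cauchy[OF l] \<delta>(1)] by blast
    have "dist (x (Suc m)) (x (Suc n)) < e" if "m \<ge> M" "n > m" for m n
    proof -
      have "lyapunov (x (Suc n)) (x (Suc m)) < \<delta>"
        using step[of "Suc m" "Suc n"] M[of n m] that by simp
      then show ?thesis
        using \<delta>(2)[of "x (Suc n)" "x (Suc m)"] R by (simp add: dist_norm norm_minus_commute)
    qed
    then show "\<exists>M. \<forall>m\<ge>M. \<forall>n>m. dist (x (Suc m)) (x (Suc n)) < e" by blast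
  qed
  then obtain w where "(\<lambda>n. x (Suc n)) \<longlonglongrightarrow> w"
    using Cauchy_convergent convergent_def by blast
  then have x_lim: "x \<longlonglongrightarrow> w" by (rule LIMSEQ_imp_Suc)
  \<comment> \<open>Membership of the next iterate in the next set bounds its distance to
    \<open>q\<close> by its distance to the current iterate, and \<open>step\<close> bounds the
    latter by an increment of a convergent sequence.\<close>
  have "(\<lambda>n. lyapunov (x (Suc (Suc n))) (q (Suc n))) \<longlonglongrightarrow> 0"
  proof (rule tendsto_sandwich[OF _ _ tendsto_const])
    show "(\<lambda>n. lyapunov (x (Suc (Suc n))) x0 - lyapunov (x (Suc n)) x0) \<longlonglongrightarrow> 0"
      using tendsto_diff[OF LIMSEQ_Suc[OF l] l] by simp
    have "lyapunov (x (Suc (Suc n))) (q (Suc n)) \<le> lyapunov (x (Suc (Suc n))) x0 - lyapunov (x (Suc n)) x0" for n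
      using xC[of "Suc (Suc n)"] CSuc[of "Suc n"] step[of "Suc n" "Suc (Suc n)"] by simp
    then show "\<forall>\<^sub>F n in sequentially. lyapunov (x (Suc (Suc n))) (q (Suc n)) \<le>
        lyapunov (x (Suc (Suc n))) x0 - lyapunov (x (Suc n)) x0"
      by simp
  qed (simp add: lyapunov_nonneg[OF us])
  then have "(\<lambda>n. x (Suc (Suc n)) - q (Suc n)) \<longlonglongrightarrow> 0"
    using R by (intro lyapunov_tendsto_0[OF us uc] BseqI'[of _ R]) auto
  from tendsto_diff[OF LIMSEQ_Suc[OF LIMSEQ_Suc[OF x_lim]] this]
  have q_lim: "q \<longlonglongrightarrow> w" by (intro LIMSEQ_imp_Suc[of q]) simp
  have "w \<in> argmin_set (h k)" if k: "k \<ge> 1" for k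
  proof -
    define N where "N = {n. n \<ge> 1 \<and> \<rho> n = k}"
    have N: "infinite N" using \<rho>(2)[OF k] by (simp add: N_def)
    \<comment> \<open>Along the indices with \<open>\<rho> n = k\<close> the function
      \<open>h k\<close> is fixed, so the subgradient inequalities concern a single function and can
      pass to the limit.\<close>
    define s where "s = enumerate N"
    have s: "strict_mono s" and sN: "\<And>n. s n \<ge> 1" "\<And>n. \<rho> (s n) = k"
      using strict_mono_enumerate[OF N] enumerate_in_set[OF N] by (auto simp: s_def N_def)
    show ?thesis
    proof (rule minimizer_of_subgradient_limit[OF us lsc[OF k] _ _ a])
      show "(\<lambda>n. x (s n)) \<longlonglongrightarrow> w" "(\<lambda>n. q (s n)) \<longlonglongrightarrow> w"
        using LIMSEQ_subseq_LIMSEQ[OF x_lim s] LIMSEQ_subseq_LIMSEQ[OF q_lim s] by (auto simp: o_def)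
      show "a \<le> r (s n)" for n using r sN by simp
      show "(duality_map (x (s n)) - duality_map (q (s n))) /\<^sub>R r (s n) \<in> subdifferential (h k) (q (s n))" for n
        using sub[OF sN(1), of n] by (simp add: sN(2))
    qed
  qed
  then have w: "w \<in> B3" using B3(1) by auto
  have "gen_proj B3 x0 = w"
  proof (rule gp(3)[OF B3(2-4) w])
    fix v assume v: "v \<in> B3"
    show "lyapunov w x0 \<le> lyapunov v x0"
      using tendsto_lyapunov[OF x_lim]
      by (rule tendsto_upperbound) (auto simp: eventually_sequentially intro!: exI[of _ 1] le v)
  qed
  then show ?thesis using x_lim by simp
qed

end
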